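(* Consider Smoothed GDA run with constant parameters satisfying the step-size conditions for Smoothed GDA listed in the context, and denote by $(x^T,y^T,z^T)$ the output after $T$ iterations. Then there exist an $\ell$-smooth function $f$ (with domains $\mathcal X,\mathcal Y$, satisfying the assumptions in the context) and an initialization $(x^0,y^0,z^0)$ such that both of the following hold: (i) (Game stationarity) Smoothed GDA requires at least $T=\Omega\big(\ell^3D_{\mathcal Y}^2\Delta_{\Psi_2}/\epsilon^4\big)$ iterations to guarantee that $(x^T,y^T)$ is an $\epsilon$-GS of $\min_{x\in\mathcal X}\max_{y\in\mathcal Y}f(x,y)$. (ii) (Optimization stationarity) Smoothed GDA requires at least $T=\Omega\big(\ell^3D_{\mathcal Y}^2\Delta_{\Psi_2}/\epsilon^4\big)$ iterations to guarantee that $x^T$ is an $\epsilon$-OS of $\min_{x\in\mathcal X}\max_{y\in\mathcal Y}f(x,y)$.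
   Context: Setting: $f:\mathbb R^n\times\mathbb R^d\to\mathbb R$; $\mathcal X\subseteq\mathbb R^n$ is nonempty, closed and convex; $\mathcal Y\subseteq\mathbb R^d$ is nonempty, compact and convex with $0\in\mathcal Y$ and diameter $D_{\mathcal Y}>0$. The function $f$ is continuously differentiable and $\ell$-smooth ($\ell>0$): for all $x,x'\in\mathcal X$, $y,y'\in\mathcal Y$, both $\|\nabla_xf(x,y)-\nabla_xf(x',y')\|$ and $\|\nabla_yf(x,y)-\nabla_yf(x',y')\|$ are at most $\ell(\|x-x'\|+\|y-y'\|)$. For each $x\in\mathcal X$, $f(x,\cdot)$ is concave. Stationarity: $\iota_S$ is the indicator function of a set $S$ ($0$ on $S$, $+\infty$ outside), and $\partial\iota_S$ its subdifferential. A pair $(x,y)\in\mathcal X\times\mathcal Y$ is an $\epsilon$-game-stationary point ($\epsilon$-GS) if $\mathrm{dist}(0,\nabla_xf(x,y)+\partial\iota_{\mathcal X}(x))\le\epsilon$ and $\mathrm{dist}(0,-\nabla_yf(x,y)+\partial\iota_{\mathcal Y}(y))\le\epsilon$. Let $\Phi(x)=\max_{y'\in\mathcal Y}f(x,y')+\iota_{\mathcal X}(x)$. A point $x\in\mathcal X$ is an $\epsilon$-optimization-stationary point ($\epsilon$-OS) if $\|\mathrm{prox}_{\frac{1}{2\ell}\Phi}(x)-x\|\le\frac{\epsilon}{2\ell}$, where $\mathrm{prox}_{\frac1{2\ell}\Phi}(x)=\arg\min_{w}\{\Phi(w)+\ell\|w-x\|^2\}$. Smoothed GDA (constant parameters):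 let $F(x,y,z)=f(x,y)+\frac{r_x}{2}\|x-z\|^2$. From $(x^0,y^0,z^0)$, iterate $$x^{t+1}=\mathrm{proj}_{\mathcal X}(x^t-c\nabla_xF(x^t,y^t,z^t)),\quad y^{t+1}=\mathrm{proj}_{\mathcal Y}(y^t+\alpha\nabla_yF(x^{t+1},y^t,z^t)),\quad z^{t+1}=z^t+\beta(x^{t+1}-z^t).$$ Step-size conditions for Smoothed GDA: $r_x=\Theta(\ell)$ with $r_x>3\ell$; $\alpha=\Theta(1/\ell)$ and $0<\alpha\le\min\Big\{\frac{1}{11\ell},\frac{c^2(r_x-\ell)^2}{4\ell(1+c(r_x-\ell))^2}\Big\}$; $c=\Theta(1/\ell)$ and $0<c<\frac{1}{r_x+\ell}$; $0<\beta\le\min\Big\{\frac1{36},\frac{(r_x-\ell)^2}{384r_x(r_x+\ell)^2}\Big\}$ and $\beta=\Theta\big(\epsilon^2/(\ell^2D_{\mathcal Y}^2)\big)$. Initial gap: $\Delta_{\Psi_2}=\Psi_2^0(x^0,y^0,z^0)-\min_{x\in\mathcal X}\max_{y\in\mathcal Y}f(x,y)$, where $\Psi_2^0(x,y,z)=F(x,y,z)-2\min_{x'\in\mathcal X}F(x',y,z)+2\min_{x'\in\mathcal X}\max_{y'\in\mathcal Y}F(x',y',z)$. Conventions: $\epsilon\in(0,1)$ is a sufficiently small positive number. "Requires at least $T=\Omega(\cdot)$ iterations" means that any $T$ for which the $T$-th iterate has the stated stationarity property satisfies $T=\Omega(\cdot)$. $\Omega$ and $\Theta$ hide positive constants not depending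 on $\epsilon,\ell,D_{\mathcal Y},\Delta_{\Psi_2},T$. *)

theory Defs
  imports "HOL-Analysis.Analysis"
begin

definition grad :: "('a::real_inner \<Rightarrow> real) \<Rightarrow> 'a \<Rightarrow> 'a" where
  "grad g x = (THE D. GDERIV g x :> D)"

definition cont_diff :: "('a::euclidean_space \<Rightarrow> 'b::euclidean_space \<Rightarrow> real) \<Rightarrow> bool" where
  "cont_diff f \<longleftrightarrow>
     (\<exists>g. (\<forall>p. GDERIV (\<lambda>(x, y). f x y) p :> g p) \<and> continuous_on UNIV g)"

definition l_smooth ::
    "real \<Rightarrow> 'a::euclidean_space set \<Rightarrow> 'b::euclidean_space set \<Rightarrow> ('a \<Rightarrow> 'b \<Rightarrow> real) \<Rightarrow> bool" where
  "l_smooth l X Y f \<longleftrightarrow>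
     (\<forall>x\<in>X. \<forall>x'\<in>X. \<forall>y\<in>Y. \<forall>y'\<in>Y.
        norm (grad (\<lambda>u. f u y) x - grad (\<lambda>u. f u y') x') \<le> l * (norm (x - x') + norm (y - y')) \<and>
        norm (grad (f x) y - grad (f x') y') \<le> l * (norm (x - x') + norm (y - y')))"

definition max_over :: "'b set \<Rightarrow> ('a \<Rightarrow> 'b \<Rightarrow> real) \<Rightarrow> 'a \<Rightarrow> real" where
  "max_over Y f x = (SUP y\<in>Y. f x y)"

text \<open>The last conjunct says that the value \<open>min\<^sub>x max\<^sub>y f x y\<close>, which enters the initial gap, is
  attained. Without it the real infimum of a set that is unbounded below would be an
  unspecified number.\<close>

definition nc_c_problem ::
    "real \<Rightarrow> real \<Rightarrow> 'a::euclidean_space set \<Rightarrow> 'b::euclidean_space set \<Rightarrow> ('a \<Rightarrow> 'b \<Rightarrow> real) \<Rightarrow> bool" where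
  "nc_c_problem l D X Y f \<longleftrightarrow>
     X \<noteq> {} \<and> closed X \<and> convex X \<and>
     Y \<noteq> {} \<and> compact Y \<and> convex Y \<and> 0 \<in> Y \<and> diameter Y = D \<and>
     cont_diff f \<and> l_smooth l X Y f \<and>
     (\<forall>x\<in>X. concave_on UNIV (f x)) \<and>
     (\<exists>xm\<in>X. \<forall>x\<in>X. max_over Y f xm \<le> max_over Y f x)"

definition indicat_fun :: "'a set \<Rightarrow> 'a \<Rightarrow> ereal" where
  "indicat_fun S x = (if x \<in> S then 0 else \<infinity>)"

definition subdifferential :: "('a::real_inner \<Rightarrow> ereal) \<Rightarrow> 'a \<Rightarrow> 'a set" where
  "subdifferential g x =
     {v. \<bar>g x\<bar> \<noteq> \<infinity> \<and> (\<forall>u. g x + ereal (v \<bullet> (u - x)) \<le> g u)}"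

text \<open>For \<open>x \<in> S\<close> the set \<open>subdifferential (indicat_fun S) x\<close> contains 0, so \<^const>\<open>infdist\<close> is
  below never applied to an empty set (where it would be 0).\<close>

definition game_stationary ::
    "real \<Rightarrow> 'a::euclidean_space set \<Rightarrow> 'b::euclidean_space set \<Rightarrow> ('a \<Rightarrow> 'b \<Rightarrow> real) \<Rightarrow> 'a \<Rightarrow> 'b \<Rightarrow> bool" where
  "game_stationary eps X Y f x y \<longleftrightarrow>
     x \<in> X \<and> y \<in> Y \<and>
     infdist 0 ((\<lambda>v. grad (\<lambda>u. f u y) x + v) ` subdifferential (indicat_fun X) x) \<le> eps \<and>
     infdist 0 ((\<lambda>v. - grad (f x) y + v) ` subdifferential (indicat_fun Y) y) \<le> eps"

definition Phi :: "'a set \<Rightarrow> 'b set \<Rightarrow> ('a \<Rightarrow> 'b \<Rightarrow> real) \<Rightarrow> 'a \<Rightarrow> ereal" where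
  "Phi X Y f x = ereal (max_over Y f x) + indicat_fun X x"

definition prox :: "real \<Rightarrow> ('a::real_normed_vector \<Rightarrow> ereal) \<Rightarrow> 'a \<Rightarrow> 'a" where
  "prox lam g x = (ARG_MIN (\<lambda>w. g w + ereal (1 / (2 * lam) * (norm (w - x))\<^sup>2)) w. True)"

definition opt_stationary ::
    "real \<Rightarrow> real \<Rightarrow> 'a::euclidean_space set \<Rightarrow> 'b::euclidean_space set \<Rightarrow> ('a \<Rightarrow> 'b \<Rightarrow> real) \<Rightarrow> 'a \<Rightarrow> bool" where
  "opt_stationary l eps X Y f x \<longleftrightarrow>
     x \<in> X \<and> norm (prox (1 / (2 * l)) (Phi X Y f) x - x) \<le> eps / (2 * l)"

definition smoothed ::
    "real \<Rightarrow> ('a::real_normed_vector \<Rightarrow> 'b \<Rightarrow> real) \<Rightarrow> 'a \<Rightarrow> 'b \<Rightarrow> 'a \<Rightarrow> real" where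
  "smoothed r f x y z = f x y + r / 2 * (norm (x - z))\<^sup>2"

fun sgda_step ::
    "real \<Rightarrow> real \<Rightarrow> real \<Rightarrow> real \<Rightarrow> 'a::euclidean_space set \<Rightarrow> 'b::euclidean_space set \<Rightarrow>
     ('a \<Rightarrow> 'b \<Rightarrow> real) \<Rightarrow> 'a \<times> 'b \<times> 'a \<Rightarrow> 'a \<times> 'b \<times> 'a" where
  "sgda_step r c \<alpha> \<beta> X Y f (x, y, z) =
     (let x' = closest_point X (x - c *\<^sub>R grad (\<lambda>u. smoothed r f u y z) x);
          y' = closest_point Y (y + \<alpha> *\<^sub>R grad (\<lambda>v. smoothed r f x' v z) y)
      in (x', y', z + \<beta> *\<^sub>R (x' - z)))"

definition sgda ::
    "real \<Rightarrow> real \<Rightarrow> real \<Rightarrow> real \<Rightarrow> 'a::euclidean_space set \<Rightarrow> 'b::euclidean_space set \<Rightarrow>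
     ('a \<Rightarrow> 'b \<Rightarrow> real) \<Rightarrow> 'a \<times> 'b \<times> 'a \<Rightarrow> nat \<Rightarrow> 'a \<times> 'b \<times> 'a" where
  "sgda r c \<alpha> \<beta> X Y f s t = (sgda_step r c \<alpha> \<beta> X Y f ^^ t) s"

text \<open>All extrema below are attained for \<open>nc_c_problem l D X Y f\<close> and \<open>r > l\<close>: \<open>Y\<close> is compact
  and the functions minimized in the definition of \<open>Psi2\<close> are strongly convex in \<open>x'\<close> on \<open>X\<close>.
  Hence \<open>INF\<close> and \<open>SUP\<close> are genuine minima and maxima.\<close>

definition Psi2 ::
    "real \<Rightarrow> 'a::euclidean_space set \<Rightarrow> 'b::euclidean_space set \<Rightarrow> ('a \<Rightarrow> 'b \<Rightarrow> real) \<Rightarrow> 'a \<Rightarrow> 'b \<Rightarrow> 'a \<Rightarrow> real" where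
  "Psi2 r X Y f x y z =
     smoothed r f x y z
     - 2 * (INF x'\<in>X. smoothed r f x' y z)
     + 2 * (INF x'\<in>X. SUP y'\<in>Y. smoothed r f x' y' z)"

definition initial_gap ::
    "real \<Rightarrow> 'a::euclidean_space set \<Rightarrow> 'b::euclidean_space set \<Rightarrow> ('a \<Rightarrow> 'b \<Rightarrow> real) \<Rightarrow> 'a \<Rightarrow> 'b \<Rightarrow> 'a \<Rightarrow> real" where
  "initial_gap r X Y f x0 y0 z0 = Psi2 r X Y f x0 y0 z0 - (INF x\<in>X. max_over Y f x)"

text \<open>\<open>theta_within (a, b) u g\<close> is \<open>u = \<Theta>(g)\<close> with hidden constants \<open>a\<close> and \<open>b\<close>.\<close>

definition theta_within :: "real \<times> real \<Rightarrow> real \<Rightarrow> real \<Rightarrow> bool" where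
  "theta_within ab u g \<longleftrightarrow> fst ab * g \<le> u \<and> u \<le> snd ab * g"

definition stepsize_conditions ::
    "real \<times> real \<Rightarrow> real \<times> real \<Rightarrow> real \<times> real \<Rightarrow> real \<times> real \<Rightarrow>
     real \<Rightarrow> real \<Rightarrow> real \<Rightarrow> real \<Rightarrow> real \<Rightarrow> real \<Rightarrow> real \<Rightarrow> bool" where
  "stepsize_conditions Kr Kc K\<alpha> K\<beta> l D eps r c \<alpha> \<beta> \<longleftrightarrow>
     theta_within Kr r l \<and> r > 3 * l \<and>
     theta_within K\<alpha> \<alpha> (1 / l) \<and> 0 < \<alpha> \<and>
     \<alpha> \<le> min (1 / (11 * l)) (c\<^sup>2 * (r - l)\<^sup>2 / (4 * l * (1 + c * (r - l))\<^sup>2)) \<and>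
     theta_within Kc c (1 / l) \<and> 0 < c \<and> c < 1 / (r + l) \<and>
     0 < \<beta> \<and> \<beta> \<le> min (1 / 36) ((r - l)\<^sup>2 / (384 * r * (r + l)\<^sup>2)) \<and>
     theta_within K\<beta> \<beta> (eps\<^sup>2 / (l\<^sup>2 * D\<^sup>2))"

end

theory Submission
  imports Defs
begin

text \<open>The hard instance does not use \<open>y\<close> at all: \<open>f x y = 2 * \<epsilon> * (e \<bullet> x)\<close> on the half-space
  \<open>e \<bullet> x \<ge> 0\<close> with a unit vector \<open>e\<close>, started at \<open>x0 = z0 = (\<Delta> / (2 * \<epsilon>)) e\<close>. Away from the
  boundary the slope \<open>2 * \<epsilon>\<close> rules out both kinds of stationarity, so the iterate has to travel
  a distance of order \<open>\<Delta> / \<epsilon>\<close>. The proximal term ties \<open>x\<close> to \<open>z\<close>: along \<open>e\<close>, \<open>x\<close> never falls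
  behind \<open>z\<close> by more than \<open>2 * \<epsilon> / r\<close>. Hence \<open>z\<close> moves by at most \<open>2 * \<epsilon> * \<beta> / r\<close> per step, which
  is of order \<open>\<epsilon> ^ 3 / (l ^ 3 * D\<^sup>2)\<close>.\<close>

section \<open>Gradients, half-space geometry and the linear instance\<close>

text \<open>Uniqueness of the derivative resolves the definite description in \<open>grad\<close>,
  so every gradient below is found by exhibiting one \<open>GDERIV\<close> fact.\<close>

lemma grad_eqI:
  assumes "GDERIV g x :> D"
  shows "grad g x = D"
  unfolding grad_def
proof (rule the_equality)
  show "GDERIV g x :> D" by (rule assms)
  fix D' assume "GDERIV g x :> D'"
  then have "(\<lambda>h. h \<bullet> D') = (\<lambda>h. h \<bullet> D)"
    using assms unfolding gderiv_def by (rule has_derivative_unique)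
  then have "\<forall>h. h \<bullet> D' = h \<bullet> D"
    by (simp add: fun_eq_iff)
  then show "D' = D"
    by (simp only: vector_eq_ldot)
qed

definition halfspace :: "'a::euclidean_space \<Rightarrow> 'a set" where
  "halfspace e = {x. 0 \<le> e \<bullet> x}"

definition lin_obj :: "real \<Rightarrow> 'a::euclidean_space \<Rightarrow> 'a \<Rightarrow> 'b::euclidean_space \<Rightarrow> real" where
  "lin_obj s e x y = s * (e \<bullet> x)"

lemma grad_lin_obj_fst: "grad (\<lambda>u. lin_obj s e u y) x = s *\<^sub>R e"
  unfolding lin_obj_def
  by (rule grad_eqI) (auto simp: gderiv_def inner_commute intro!: derivative_eq_intros)

lemma grad_lin_obj_snd: "grad (lin_obj s e x) y = 0"
  unfolding lin_obj_def[abs_def] by (rule grad_eqI) (rule GDERIV_const)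

lemma grad_smoothed_lin_obj:
  "grad (\<lambda>u. smoothed r (lin_obj s e) u y z) x = s *\<^sub>R e + r *\<^sub>R (x - z)"
  unfolding smoothed_def lin_obj_def power2_norm_eq_inner
  by (rule grad_eqI)
    (auto simp: gderiv_def fun_eq_iff inner_commute algebra_simps intro!: derivative_eq_intros)

lemma zero_in_halfspace: "0 \<in> halfspace e"
  by (simp add: halfspace_def)

lemma closed_halfspace: "closed (halfspace e)"
  unfolding halfspace_def by (intro closed_Collect_le continuous_intros)

lemma convex_halfspace: "convex (halfspace e)"
  unfolding halfspace_def using convex_halfspace_ge[of 0 e] by simp

text \<open>A projection either fixes \<open>p\<close> or lifts a negative component to a
  nonnegative one. This one-sided estimate replaces an explicit projection formula in the analysis
  of the iteration.\<close>

lemma inner_closest_point_halfspace: "e \<bullet> p \<le> e \<bullet> closest_point (halfspace e) p"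
proof (cases "p \<in> halfspace e")
  case True
  then show ?thesis by (simp add: closest_point_self)
next
  case False
  have "closest_point (halfspace e) p \<in> halfspace e"
    by (metis closest_point_in_set closed_halfspace zero_in_halfspace empty_iff)
  with False show ?thesis by (simp add: halfspace_def)
qed

lemma cont_diff_lin_obj: "cont_diff (lin_obj s e :: 'a::euclidean_space \<Rightarrow> 'b::euclidean_space \<Rightarrow> real)"
  unfolding cont_diff_def
proof (intro exI[of _ "\<lambda>_. (s *\<^sub>R e, 0)"] conjI allI continuous_on_const)
  fix p :: "'a \<times> 'b"
  show "GDERIV (\<lambda>(x, y). lin_obj s e x y) p :> (s *\<^sub>R e, 0)"
    unfolding gderiv_def lin_obj_def case_prod_unfold
    by (auto simp: fun_eq_iff inner_commute intro!: derivative_eq_intros)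
qed

lemma max_over_lin_obj:
  assumes "Y \<noteq> {}"
  shows "max_over Y (lin_obj s e) x = s * (e \<bullet> x)"
  using assms by (simp add: max_over_def lin_obj_def)

text \<open>Both partial gradients are constant, so smoothness holds for every positive
  \<open>l\<close>. The half-space bounds the linear objective below, with minimum 0 at the
  origin.\<close>

lemma nc_c_problem_lin_obj:
  assumes "l > 0" "D > 0" "s \<ge> 0"
  shows "nc_c_problem l D (halfspace e) (cball 0 (D / 2)) (lin_obj s e)"
  unfolding nc_c_problem_def
proof (intro conjI)
  show "l_smooth l (halfspace e) (cball 0 (D / 2)) (lin_obj s e)"
    using assms by (simp add: l_smooth_def grad_lin_obj_fst grad_lin_obj_snd)
  show "\<forall>x\<in>halfspace e. concave_on UNIV (lin_obj s e x)"
    by (simp add: concave_on_iff lin_obj_def flip: distrib_right)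
  show "\<exists>xm\<in>halfspace e. \<forall>x\<in>halfspace e.
      max_over (cball 0 (D / 2)) (lin_obj s e) xm \<le> max_over (cball 0 (D / 2)) (lin_obj s e) x"
    using assms by (intro bexI[of _ 0]) (auto simp: max_over_lin_obj halfspace_def)
  show "halfspace e \<noteq> {}"
    using zero_in_halfspace by blast
qed (use assms closed_halfspace convex_halfspace cont_diff_lin_obj
      in \<open>auto simp: diameter_cball\<close>)

text \<open>The objective ignores \<open>y\<close>, so the two minima in \<open>Psi2\<close>
  coincide and cancel; taking \<open>z = x\<close> removes the quadratic term, and the min-max value
  is 0.\<close>

lemma initial_gap_lin_obj:
  assumes "Y \<noteq> {}" "s \<ge> 0"
  shows "initial_gap r (halfspace e) Y (lin_obj s e) x y x = s * (e \<bullet> x)"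
proof -
  have "(INF x\<in>halfspace e. max_over Y (lin_obj s e) x) = 0"
    using assms
    by (intro cInf_eq_minimum) (auto simp: max_over_lin_obj halfspace_def image_iff intro!: exI[of _ 0])
  then show ?thesis
    using assms by (simp add: initial_gap_def Psi2_def smoothed_def lin_obj_def)
qed

section \<open>Stationarity forces the iterate close to the boundary\<close>

lemma game_stationary_lin_obj:
  assumes "norm e = 1" "eps < s"
    and "game_stationary eps (halfspace e) Y (lin_obj s e) x y"
  shows "e \<bullet> x = 0"
proof (rule ccontr)
  assume "e \<bullet> x \<noteq> 0"
  let ?S = "(\<lambda>v. s *\<^sub>R e + v) ` subdifferential (indicat_fun (halfspace e)) x"
  have xX: "x \<in> halfspace e" and dist: "infdist 0 ?S \<le> eps"
    using assms(3) by (auto simp: game_stationary_def grad_lin_obj_fst)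
  have ee: "e \<bullet> e = 1"
    using assms(1) by (simp add: norm_eq_1)
  have pos: "e \<bullet> x > 0"
    using xX \<open>e \<bullet> x \<noteq> 0\<close> by (simp add: halfspace_def)
  \<comment> \<open>Nonemptiness makes \<open>infdist\<close> a genuine infimum instead of its
    default value 0.\<close>
  have ne: "?S \<noteq> {}"
    using xX by (auto simp: subdifferential_def indicat_fun_def intro!: exI[of _ 0])
  have "s \<le> dist 0 w" if wS: "w \<in> ?S" for w
  proof -
    obtain v where w: "w = s *\<^sub>R e + v" and v: "v \<in> subdifferential (indicat_fun (halfspace e)) x"
      using wS by auto
    \<comment> \<open>Testing the subgradient inequality at the foot of \<open>x\<close> on the
      boundary hyperplane shows that \<open>v\<close> has no component against \<open>e\<close>, so
      it cannot cancel \<open>s *\<^sub>R e\<close>.\<close>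
    let ?u = "x - (e \<bullet> x) *\<^sub>R e"
    have "?u \<in> halfspace e"
      by (simp add: halfspace_def inner_diff_right ee)
    then have "v \<bullet> (?u - x) \<le> 0"
      using v xX by (auto simp: subdifferential_def indicat_fun_def dest!: spec[of _ ?u])
    then have "e \<bullet> v \<ge> 0"
      using pos by (simp add: inner_commute zero_le_mult_iff)
    then have "s \<le> e \<bullet> w"
      by (simp add: w inner_add_right ee)
    also have "\<dots> \<le> norm w"
      using norm_cauchy_schwarz[of e w] assms(1) by simp
    finally show ?thesis by simp
  qed
  then have "s \<le> infdist 0 ?S"
    unfolding infdist_notempty[OF ne] by (intro cINF_greatest[OF ne])
  with dist assms(2) show False by simp
qed

text \<open>Strictness makes the minimizer unique, which pins down the choice made by
  \<open>ARG_MIN\<close>.\<close>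

lemma prox_eqI:
  assumes "\<And>w. w \<noteq> v \<Longrightarrow>
    g v + ereal (1 / (2 * lam) * (norm (v - x))\<^sup>2) < g w + ereal (1 / (2 * lam) * (norm (w - x))\<^sup>2)"
  shows "prox lam g x = v"
  unfolding prox_def arg_min_def is_arg_min_def
  by (rule some_equality) (use assms in \<open>metis less_asym less_irrefl\<close>)+

text \<open>The unconstrained minimizer is one step of length \<open>s / (2 * l)\<close> down the
  slope; the last assumption keeps it inside the half-space.\<close>

lemma prox_lin_obj:
  assumes "norm e = 1" "l > 0" "Y \<noteq> {}" "s \<ge> 0" "e \<bullet> x \<ge> s / (2 * l)"
  shows "prox (1 / (2 * l)) (Phi (halfspace e) Y (lin_obj s e)) x = x - (s / (2 * l)) *\<^sub>R e"
proof (rule prox_eqI)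
  let ?v = "x - (s / (2 * l)) *\<^sub>R e"
  fix w assume "w \<noteq> ?v"
  have ee: "e \<bullet> e = 1"
    using assms(1) by (simp add: norm_eq_1)
  have v: "?v \<in> halfspace e"
    using assms(5) by (simp add: halfspace_def inner_diff_right ee)
  \<comment> \<open>completing the square\<close>
  have "s * (e \<bullet> w) + l * (norm (w - x))\<^sup>2 =
      s * (e \<bullet> ?v) + l * (norm (?v - x))\<^sup>2 + l * (norm (w - ?v))\<^sup>2"
  proof -
    have "w - ?v = (w - x) + (s / (2 * l)) *\<^sub>R e"
      by simp
    then have 1: "(norm (w - ?v))\<^sup>2 =
        (norm (w - x))\<^sup>2 + (s * (e \<bullet> w) / l - s * (e \<bullet> x) / l) + (s / (2 * l))\<^sup>2"
      unfolding power2_norm_eq_inner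
      by (simp add: inner_add_left inner_add_right inner_diff_right inner_commute ee power2_eq_square
          right_diff_distrib diff_divide_distrib)
    have 2: "(norm (?v - x))\<^sup>2 = (s / (2 * l))\<^sup>2"
      using assms(1) by (simp add: power_divide flip: abs_mult)
    have 3: "e \<bullet> ?v = e \<bullet> x - s / (2 * l)"
      by (simp add: inner_diff_right ee)
    show ?thesis
      unfolding 1 2 3 using assms(2) by (simp add: field_simps power2_eq_square)
  qed
  moreover have "l * (norm (w - ?v))\<^sup>2 > 0"
    using \<open>w \<noteq> ?v\<close> assms(2) by simp
  ultimately have "s * (e \<bullet> ?v) + l * (norm (?v - x))\<^sup>2 < s * (e \<bullet> w) + l * (norm (w - x))\<^sup>2"
    by linarith
  \<comment> \<open>Outside the half-space the value at \<open>w\<close> is infinite; inside, this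
    is the real inequality just shown.\<close>
  then show "Phi (halfspace e) Y (lin_obj s e) ?v + ereal (1 / (2 * (1 / (2 * l))) * (norm (?v - x))\<^sup>2)
      < Phi (halfspace e) Y (lin_obj s e) w + ereal (1 / (2 * (1 / (2 * l))) * (norm (w - x))\<^sup>2)"
    using v by (simp add: Phi_def indicat_fun_def max_over_lin_obj[OF assms(3)])
qed

text \<open>Farther from the boundary the proximal step has its full length
  \<open>s / (2 * l)\<close>, which exceeds the tolerance.\<close>

lemma opt_stationary_lin_obj:
  assumes "norm e = 1" "l > 0" "Y \<noteq> {}" "s \<ge> 0" "eps < s"
    and "opt_stationary l eps (halfspace e) Y (lin_obj s e) x"
  shows "e \<bullet> x < s / (2 * l)"
proof (rule ccontr)
  assume "\<not> e \<bullet> x < s / (2 * l)"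
  then have "prox (1 / (2 * l)) (Phi (halfspace e) Y (lin_obj s e)) x = x - (s / (2 * l)) *\<^sub>R e"
    using assms by (intro prox_lin_obj) auto
  then have "s / (2 * l) \<le> eps / (2 * l)"
    using assms by (simp add: opt_stationary_def)
  with assms(2,5) show False
    by (simp add: divide_le_cancel)
qed

section \<open>Slow drift of the iterates and the iteration count\<close>

text \<open>The lag bound is an invariant of the iteration and limits how far \<open>z\<close> can
  descend per step; the two bounds are therefore proved in one induction.\<close>

lemma sgda_lin_obj_bounds:
  assumes "norm e = 1" "r > 0" "s \<ge> 0" "0 \<le> c" "c * r \<le> 1" "0 \<le> \<beta>" "\<beta> \<le> 1"
    and "sgda r c \<alpha> \<beta> (halfspace e) Y (lin_obj s e) (x0, y0, x0) T = (x, y, z)"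
  shows "e \<bullet> x - e \<bullet> z \<ge> - (s / r) \<and> e \<bullet> z \<ge> e \<bullet> x0 - \<beta> * (s / r) * real T"
  using assms(8)
proof (induction T arbitrary: x y z)
  case 0
  then show ?case
    using assms(2,3) by (auto simp: sgda_def)
next
  case (Suc T)
  obtain x1 y1 z1 where st: "sgda r c \<alpha> \<beta> (halfspace e) Y (lin_obj s e) (x0, y0, x0) T = (x1, y1, z1)"
    by (metis prod_cases3)
  note IH = Suc.IH[OF st]
  have "sgda_step r c \<alpha> \<beta> (halfspace e) Y (lin_obj s e) (x1, y1, z1) = (x, y, z)"
    using Suc.prems st by (simp add: sgda_def)
  then have x: "x = closest_point (halfspace e) (x1 - c *\<^sub>R (s *\<^sub>R e + r *\<^sub>R (x1 - z1)))"
    and z: "z = z1 + \<beta> *\<^sub>R (x - z1)"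
    by (auto simp: Let_def grad_smoothed_lin_obj)
  have ee: "e \<bullet> e = 1"
    using assms(1) by (simp add: norm_eq_1)
  have "e \<bullet> x \<ge> e \<bullet> (x1 - c *\<^sub>R (s *\<^sub>R e + r *\<^sub>R (x1 - z1)))"
    unfolding x by (rule inner_closest_point_halfspace)
  then have 1: "e \<bullet> x - e \<bullet> z1 \<ge> (1 - c * r) * (e \<bullet> x1 - e \<bullet> z1) - c * s"
    by (simp add: algebra_simps ee)
  have "(1 - c * r) * (e \<bullet> x1 - e \<bullet> z1) \<ge> (1 - c * r) * (- (s / r))"
    using IH assms(5) by (intro mult_left_mono) auto
  \<comment> \<open>The value \<open>- (s / r)\<close> is the fixed point of the affine lag
    recursion, which is monotone because \<open>c * r \<le> 1\<close>.\<close>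
  moreover have "(1 - c * r) * (- (s / r)) - c * s = - (s / r)"
    using assms(2) by (simp add: field_simps)
  ultimately have 2: "e \<bullet> x - e \<bullet> z1 \<ge> - (s / r)"
    using 1 by linarith
  \<comment> \<open>Averaging moves \<open>z\<close> towards \<open>x\<close>, so the lag only
    shrinks.\<close>
  have "e \<bullet> x - e \<bullet> z = (1 - \<beta>) * (e \<bullet> x - e \<bullet> z1)"
    by (simp add: z algebra_simps)
  also have "\<dots> \<ge> (1 - \<beta>) * (- (s / r))"
    using 2 assms(7) by (intro mult_left_mono) auto
  moreover have "(1 - \<beta>) * (- (s / r)) = - (s / r) + \<beta> * (s / r)"
    by (simp add: left_diff_distrib diff_divide_distrib)
  moreover have "\<beta> * (s / r) \<ge> 0"
    using assms(2,3,6) by simp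
  ultimately have "e \<bullet> x - e \<bullet> z \<ge> - (s / r)"
    by linarith
  moreover have "e \<bullet> z = e \<bullet> z1 + \<beta> * (e \<bullet> x - e \<bullet> z1)"
    by (simp add: z algebra_simps)
  moreover have "\<beta> * (e \<bullet> x - e \<bullet> z1) \<ge> \<beta> * (- (s / r))"
    using 2 assms(6) by (rule mult_left_mono)
  moreover have "\<beta> * (s / r) * real (Suc T) = \<beta> * (s / r) * real T - \<beta> * (- (s / r))"
    by (simp add: ring_distribs)
  ultimately show ?case
    using IH by linarith
qed

text \<open>Here \<open>p\<close> stands for the component of the final \<open>x\<close> along
  \<open>e\<close>. At least half of the initial distance \<open>\<Delta> / (2 * \<epsilon>)\<close>
  must be covered by the drift of \<open>z\<close>; dividing by the drift per step gives the
  count.\<close>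

lemma iteration_count_bound:
  fixes l D \<Delta> \<epsilon> r \<beta> B T p :: real
  assumes "l > 0" "D > 0" "\<Delta> > 0" "B > 0" "0 < \<epsilon>" "\<epsilon> < 1" "\<epsilon> < \<Delta> * l / 8"
    and "3 * l < r" "0 < \<beta>" "\<beta> \<le> B * (\<epsilon>\<^sup>2 / (l\<^sup>2 * D\<^sup>2))" "T \<ge> 0"
    and "p \<le> \<epsilon> / l" "\<Delta> / (2 * \<epsilon>) - \<beta> * (2 * \<epsilon> / r) * T - 2 * \<epsilon> / r \<le> p"
  shows "T \<ge> 3 / (8 * B) * (l ^ 3 * D\<^sup>2 * \<Delta> / \<epsilon> ^ 4)"
proof -
  have r: "2 * \<epsilon> / r \<le> 2 * \<epsilon> / (3 * l)"
    using assms by (intro divide_left_mono) auto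
  have "\<epsilon> * \<epsilon> \<le> \<epsilon>"
    using assms(5,6) by (simp add: mult_le_cancel_right1)
  then have "8 * (\<epsilon> * \<epsilon>) \<le> \<Delta> * l"
    using assms(7) by simp
  \<comment> \<open>Cleared of denominators this reads
    \<open>20 * \<epsilon>\<^sup>2 \<le> 3 * \<Delta> * l\<close>, which follows from the preceding
    bound; this is where the threshold \<open>\<Delta> * l / 8\<close> comes from.\<close>
  then have small: "\<epsilon> / l + 2 * \<epsilon> / (3 * l) \<le> \<Delta> / (4 * \<epsilon>)"
    using assms(1,5) mult_pos_pos[OF assms(3,1)] by (simp add: field_simps)
  have "\<Delta> / (2 * \<epsilon>) = \<Delta> / (4 * \<epsilon>) + \<Delta> / (4 * \<epsilon>)"
    by simp
  with r small assms(12,13) have "\<Delta> / (4 * \<epsilon>) \<le> \<beta> * (2 * \<epsilon> / r) * T"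
    by linarith
  also have "\<dots> \<le> B * (\<epsilon>\<^sup>2 / (l\<^sup>2 * D\<^sup>2)) * (2 * \<epsilon> / (3 * l)) * T"
    using r assms by (intro mult_right_mono mult_mono) auto
  finally have "\<Delta> / (4 * \<epsilon>) \<le> T * (B * (\<epsilon>\<^sup>2 / (l\<^sup>2 * D\<^sup>2)) * (2 * \<epsilon> / (3 * l)))"
    by (simp only: mult.commute)
  then have "\<Delta> / (4 * \<epsilon>) / (B * (\<epsilon>\<^sup>2 / (l\<^sup>2 * D\<^sup>2)) * (2 * \<epsilon> / (3 * l))) \<le> T"
    using assms(1,2,4,5) by (subst pos_divide_le_eq) auto
  moreover have "\<Delta> / (4 * \<epsilon>) / (B * (\<epsilon>\<^sup>2 / (l\<^sup>2 * D\<^sup>2)) * (2 * \<epsilon> / (3 * l))) =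
      3 / (8 * B) * (l ^ 3 * D\<^sup>2 * \<Delta> / \<epsilon> ^ 4)"
    by (simp add: power2_eq_square power3_eq_cube power4_eq_xxxx mult.assoc mult.left_commute)
  ultimately show ?thesis
    by simp
qed

text \<open>The witness for \<open>\<kappa>\<close> is \<open>3 / (8 * b\<beta>)\<close>, fixed
  before \<open>l\<close>, \<open>D\<close> and \<open>\<Delta>\<close>; only the threshold for
  small \<open>\<epsilon>\<close> depends on the problem parameters.\<close>

theorem corollary3p1:
  fixes ar br ac bc a\<alpha> b\<alpha> a\<beta> b\<beta> :: real
  assumes "0 < ar" "0 < br" "0 < ac" "0 < bc" "0 < a\<alpha>" "0 < b\<alpha>" "0 < a\<beta>" "0 < b\<beta>"
  shows "\<exists>\<kappa>>0. \<forall>l>0. \<forall>D>0. \<forall>\<Delta>>0. \<exists>\<epsilon>0>0. \<forall>\<epsilon>. 0 < \<epsilon> \<and> \<epsilon> < 1 \<and> \<epsilon> < \<epsilon>0 \<longrightarrow>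
    (\<forall>r c \<alpha> \<beta>.
      stepsize_conditions (ar, br) (ac, bc) (a\<alpha>, b\<alpha>) (a\<beta>, b\<beta>) l D \<epsilon> r c \<alpha> \<beta> \<longrightarrow>
      (\<exists>(X :: (real ^ 'n) set) (Y :: (real ^ 'd) set) f x0 y0 z0.
        nc_c_problem l D X Y f \<and> x0 \<in> X \<and> y0 \<in> Y \<and>
        initial_gap r X Y f x0 y0 z0 = \<Delta> \<and>
        (\<forall>T x y z. sgda r c \<alpha> \<beta> X Y f (x0, y0, z0) T = (x, y, z) \<longrightarrow>
           game_stationary \<epsilon> X Y f x y \<longrightarrow>
           real T \<ge> \<kappa> * (l ^ 3 * D\<^sup>2 * \<Delta> / \<epsilon> ^ 4)) \<and>
        (\<forall>T x y z. sgda r c \<alpha> \<beta> X Y f (x0, y0, z0) T = (x, y, z) \<longrightarrow>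
           opt_stationary l \<epsilon> X Y f x \<longrightarrow>
           real T \<ge> \<kappa> * (l ^ 3 * D\<^sup>2 * \<Delta> / \<epsilon> ^ 4))))"
proof -
  have main: "\<exists>(X :: (real ^ 'n) set) (Y :: (real ^ 'd) set) f x0 y0 z0.
        nc_c_problem l D X Y f \<and> x0 \<in> X \<and> y0 \<in> Y \<and>
        initial_gap r X Y f x0 y0 z0 = \<Delta> \<and>
        (\<forall>T x y z. sgda r c \<alpha> \<beta> X Y f (x0, y0, z0) T = (x, y, z) \<longrightarrow>
           game_stationary \<epsilon> X Y f x y \<longrightarrow>
           real T \<ge> 3 / (8 * b\<beta>) * (l ^ 3 * D\<^sup>2 * \<Delta> / \<epsilon> ^ 4)) \<and>
        (\<forall>T x y z. sgda r c \<alpha> \<beta> X Y f (x0, y0, z0) T = (x, y, z) \<longrightarrow>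
           opt_stationary l \<epsilon> X Y f x \<longrightarrow>
           real T \<ge> 3 / (8 * b\<beta>) * (l ^ 3 * D\<^sup>2 * \<Delta> / \<epsilon> ^ 4))"
    if pos: "l > 0" "D > 0" "\<Delta> > 0" and eps: "0 < \<epsilon>" "\<epsilon> < 1" "\<epsilon> < \<Delta> * l / 8"
      and steps: "stepsize_conditions (ar, br) (ac, bc) (a\<alpha>, b\<alpha>) (a\<beta>, b\<beta>) l D \<epsilon> r c \<alpha> \<beta>"
    for l D \<Delta> \<epsilon> r c \<alpha> \<beta>
  proof -
    obtain e :: "real ^ 'n" where e: "norm e = 1"
      using vector_choose_size[of 1] by auto
    let ?X = "halfspace e" and ?Y = "cball (0 :: real ^ 'd) (D / 2)"
    \<comment> \<open>The slope is twice the tolerance, hence strictly above it; the start is then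
      scaled so that slope times distance equals \<open>\<Delta>\<close>.\<close>
    let ?f = "lin_obj (2 * \<epsilon>) e :: real ^ 'n \<Rightarrow> real ^ 'd \<Rightarrow> real"
    let ?x0 = "(\<Delta> / (2 * \<epsilon>)) *\<^sub>R e"
    have r: "3 * l < r" and "0 < c" and cr: "c < 1 / (r + l)" and \<beta>: "0 < \<beta>" "\<beta> \<le> 1 / 36"
      and \<beta>': "\<beta> \<le> b\<beta> * (\<epsilon>\<^sup>2 / (l\<^sup>2 * D\<^sup>2))"
      using steps by (auto simp: stepsize_conditions_def theta_within_def)
    have "c * r \<le> c * (r + l)"
      using \<open>0 < c\<close> pos by simp
    also have "\<dots> \<le> 1"
      using cr r pos by (simp add: field_simps)
    finally have "c * r \<le> 1" .
    have ex0: "e \<bullet> ?x0 = \<Delta> / (2 * \<epsilon>)"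
      using e by (simp add: norm_eq_1)
    have Yne: "?Y \<noteq> {}"
      using pos by simp
    \<comment> \<open>One count serves both claims: game stationarity gives component 0,
      optimization stationarity one below \<open>2 * \<epsilon> / (2 * l)\<close>, which is
      \<open>\<epsilon> / l\<close>.\<close>
    have count: "real T \<ge> 3 / (8 * b\<beta>) * (l ^ 3 * D\<^sup>2 * \<Delta> / \<epsilon> ^ 4)"
      if "sgda r c \<alpha> \<beta> ?X ?Y ?f (?x0, 0, ?x0) T = (x, y, z)" and "e \<bullet> x \<le> \<epsilon> / l" for T x y z
    proof (rule iteration_count_bound[OF pos \<open>0 < b\<beta>\<close> eps r \<beta>(1) \<beta>' _ that(2)])
      show "\<Delta> / (2 * \<epsilon>) - \<beta> * (2 * \<epsilon> / r) * real T - 2 * \<epsilon> / r \<le> e \<bullet> x"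
        using sgda_lin_obj_bounds[OF e _ _ _ \<open>c * r \<le> 1\<close> _ _ that(1)] ex0 r pos eps \<beta> \<open>0 < c\<close>
        by simp
    qed simp
    show ?thesis
    proof (intro exI[of _ ?X] exI[of _ ?Y] exI[of _ ?f] exI[of _ ?x0] exI[of _ 0] conjI allI impI)
      show "nc_c_problem l D ?X ?Y ?f"
        using pos eps by (intro nc_c_problem_lin_obj) auto
      show "?x0 \<in> ?X"
        using ex0 pos eps by (simp add: halfspace_def)
      show "0 \<in> ?Y"
        using pos by simp
      show "initial_gap r ?X ?Y ?f ?x0 0 ?x0 = \<Delta>"
        by (subst initial_gap_lin_obj[OF Yne]) (use ex0 eps in \<open>simp_all del: inner_scaleR_right\<close>)
    next
      fix T x y z
      assume it: "sgda r c \<alpha> \<beta> ?X ?Y ?f (?x0, 0, ?x0) T = (x, y, z)"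
        and "game_stationary \<epsilon> ?X ?Y ?f x y"
      then have "e \<bullet> x = 0"
        using game_stationary_lin_obj[OF e] eps by (metis mult_2 less_add_same_cancel1)
      then show "real T \<ge> 3 / (8 * b\<beta>) * (l ^ 3 * D\<^sup>2 * \<Delta> / \<epsilon> ^ 4)"
        using count[OF it] pos eps by simp
    next
      fix T x y z
      assume it: "sgda r c \<alpha> \<beta> ?X ?Y ?f (?x0, 0, ?x0) T = (x, y, z)"
        and "opt_stationary l \<epsilon> ?X ?Y ?f x"
      then have "e \<bullet> x < 2 * \<epsilon> / (2 * l)"
        using opt_stationary_lin_obj[OF e pos(1) Yne, of "2 * \<epsilon>" \<epsilon>] eps by simp
      then show "real T \<ge> 3 / (8 * b\<beta>) * (l ^ 3 * D\<^sup>2 * \<Delta> / \<epsilon> ^ 4)"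
        using count[OF it] by simp
    qed
  qed
  show ?thesis
  proof (rule exI[of _ "3 / (8 * b\<beta>)"], intro conjI allI impI)
    show "3 / (8 * b\<beta>) > 0"
      using assms(8) by simp
  next
    fix l D \<Delta> :: real
    assume "l > 0" "D > 0" "\<Delta> > 0"
    then show "\<exists>\<epsilon>0>0. \<forall>\<epsilon>. 0 < \<epsilon> \<and> \<epsilon> < 1 \<and> \<epsilon> < \<epsilon>0 \<longrightarrow>
      (\<forall>r c \<alpha> \<beta>.
        stepsize_conditions (ar, br) (ac, bc) (a\<alpha>, b\<alpha>) (a\<beta>, b\<beta>) l D \<epsilon> r c \<alpha> \<beta> \<longrightarrow>
        (\<exists>(X :: (real ^ 'n) set) (Y :: (real ^ 'd) set) f x0 y0 z0.
          nc_c_problem l D X Y f \<and> x0 \<in> X \<and> y0 \<in> Y \<and>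
          initial_gap r X Y f x0 y0 z0 = \<Delta> \<and>
          (\<forall>T x y z. sgda r c \<alpha> \<beta> X Y f (x0, y0, z0) T = (x, y, z) \<longrightarrow>
             game_stationary \<epsilon> X Y f x y \<longrightarrow>
             real T \<ge> 3 / (8 * b\<beta>) * (l ^ 3 * D\<^sup>2 * \<Delta> / \<epsilon> ^ 4)) \<and>
          (\<forall>T x y z. sgda r c \<alpha> \<beta> X Y f (x0, y0, z0) T = (x, y, z) \<longrightarrow>
             opt_stationary l \<epsilon> X Y f x \<longrightarrow>
             real T \<ge> 3 / (8 * b\<beta>) * (l ^ 3 * D\<^sup>2 * \<Delta> / \<epsilon> ^ 4))))"
      by (intro exI[of _ "\<Delta> * l / 8"] conjI allI impI main) auto
  qed
qed

end
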